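(* Let $P$ be the transition matrix of an ergodic discrete-time birth-and-death chain on $\{0, \dots, d\}$ with stationary probability mass function $\pi$ and nonnegative eigenvalues $0 \le \theta_0 \le \theta_1 \le \dots \le \theta_{d - 1} < \theta_d = 1$. For $k=0,\dots,d$ define $$Q_k := (1 - \theta_0)^{-1} \cdots (1 - \theta_{k-1})^{-1} (P - \theta_0 I) \cdots (P - \theta_{k-1} I),\qquad Q_0:=I.$$ Then the matrices $Q_k$, $0\le k\le d$, are all stochastic, and every row of $Q_d$ equals $\pi$.
   Context: A discrete-time birth-and-death chain on $\{0,\dots,d\}$ has a tridiagonal stochastic transition matrix; ergodic means irreducible and aperiodic. Eigenvalues are listed with multiplicity. $I$ is the identity matrix. A square matrix is stochastic if its entries are nonnegative and each row sums to $1$. *)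

theory Defs
  imports "Jordan_Normal_Form.Char_Poly"
begin

text \<open>The state space \<open>{0..d}\<close> corresponds to the row and column indices of
  matrices of dimension \<open>n = d + 1\<close>, which the library numbers from \<open>0\<close> to \<open>n - 1\<close>.\<close>

definition stochastic_mat :: "nat \<Rightarrow> real mat \<Rightarrow> bool" where
  "stochastic_mat n P \<longleftrightarrow> P \<in> carrier_mat n n \<and>
     (\<forall>i<n. \<forall>j<n. 0 \<le> P $$ (i, j)) \<and> (\<forall>i<n. (\<Sum>j<n. P $$ (i, j)) = 1)"

definition tridiagonal_mat :: "'a::zero mat \<Rightarrow> bool" where
  "tridiagonal_mat A \<longleftrightarrow> (\<forall>i<dim_row A. \<forall>j<dim_col A.
     Suc i < j \<or> Suc j < i \<longrightarrow> A $$ (i, j) = 0)"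

definition birth_death_mat :: "nat \<Rightarrow> real mat \<Rightarrow> bool" where
  "birth_death_mat d P \<longleftrightarrow> stochastic_mat (d + 1) P \<and> tridiagonal_mat P"

definition irreducible_mat :: "real mat \<Rightarrow> bool" where
  "irreducible_mat P \<longleftrightarrow> (\<forall>i<dim_row P. \<forall>j<dim_row P. \<exists>m. 0 < (P ^\<^sub>m m) $$ (i, j))"

definition state_period :: "real mat \<Rightarrow> nat \<Rightarrow> nat" where
  "state_period P i = Gcd {m. 0 < m \<and> 0 < (P ^\<^sub>m m) $$ (i, i)}"

definition aperiodic_mat :: "real mat \<Rightarrow> bool" where
  "aperiodic_mat P \<longleftrightarrow> (\<forall>i<dim_row P. state_period P i = 1)"

definition ergodic_mat :: "real mat \<Rightarrow> bool" where
  "ergodic_mat P \<longleftrightarrow> irreducible_mat P \<and> aperiodic_mat P"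

definition prob_vec :: "nat \<Rightarrow> real vec \<Rightarrow> bool" where
  "prob_vec n v \<longleftrightarrow> v \<in> carrier_vec n \<and> (\<forall>i<n. 0 \<le> v $ i) \<and> (\<Sum>i<n. v $ i) = 1"

definition stationary_pmf :: "real mat \<Rightarrow> real vec \<Rightarrow> bool" where
  "stationary_pmf P v \<longleftrightarrow> prob_vec (dim_row P) v \<and>
     (\<forall>j<dim_row P. (\<Sum>i<dim_row P. v $ i * P $$ (i, j)) = v $ j)"

text \<open>\<open>\<theta> 0, \<dots>, \<theta> (n - 1)\<close> lists all eigenvalues of the \<open>n \<times> n\<close> matrix \<open>A\<close>
  with algebraic multiplicity. For a real matrix this includes the requirement that
  all its complex eigenvalues are real.\<close>

definition eigenvalue_listing :: "'a::field mat \<Rightarrow> (nat \<Rightarrow> 'a) \<Rightarrow> bool" where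
  "eigenvalue_listing A \<theta> \<longleftrightarrow> char_poly A = (\<Prod>i<dim_row A. [:- \<theta> i, 1:])"

fun shifted_prod :: "'a::field mat \<Rightarrow> (nat \<Rightarrow> 'a) \<Rightarrow> nat \<Rightarrow> 'a mat" where
  "shifted_prod P \<theta> 0 = 1\<^sub>m (dim_row P)"
| "shifted_prod P \<theta> (Suc k) = shifted_prod P \<theta> k * (P - \<theta> k \<cdot>\<^sub>m 1\<^sub>m (dim_row P))"

definition spectral_poly :: "'a::field mat \<Rightarrow> (nat \<Rightarrow> 'a) \<Rightarrow> nat \<Rightarrow> 'a mat" where
  "spectral_poly P \<theta> k = (\<Prod>j<k. inverse (1 - \<theta> j)) \<cdot>\<^sub>m shifted_prod P \<theta> k"

end

theory Submission
  imports Defs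
begin

text \<open>Write \<open>\<phi>\<^sub>i\<close> and \<open>\<psi>\<^sub>j\<close> for the characteristic polynomials of the blocks of \<open>P\<close> before \<open>i\<close> and
  after \<open>j\<close>, and \<open>\<chi>\<close> for that of \<open>P\<close>. The matrix \<open>B(x)\<close> with entries
  \<open>w\<^sub>i\<^sub>j \<phi>\<^sub>i(x) \<psi>\<^sub>j(x)\<close> for \<open>i \<le> j\<close>, where \<open>w\<^sub>i\<^sub>j\<close> is the product of the off-diagonal entries of \<open>P\<close> between
  \<open>i\<close> and \<open>j\<close>, and similarly for \<open>i > j\<close>, is the adjugate of \<open>x I - P\<close>: it satisfies
  \<open>B(x) (x I - P) = \<chi>(x) I\<close>. Expanding \<open>B\<close> in the Newton basis with nodes
  \<open>\<theta>\<^sub>d, \<theta>\<^sub>d\<^sub>-\<^sub>1, \<dots>\<close> and comparing coefficients, the coefficient of index \<open>d - k\<close> is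
  \<open>(P - \<theta>\<^sub>0 I) \<cdots> (P - \<theta>\<^sub>k\<^sub>-\<^sub>1 I)\<close>. By interlacing, the \<open>s\<close>-th largest root of \<open>\<phi>\<^sub>i \<psi>\<^sub>j\<close> is at
  most the \<open>s\<close>-th largest eigenvalue, and a polynomial with this property has nonnegative Newton
  coefficients. The same comparison yields \<open>Q\<^sub>d P = Q\<^sub>d\<close>, so that each row of \<open>Q\<^sub>d\<close> is a
  stationary distribution, hence equal to \<open>\<pi>\<close>.\<close>

section \<open>Interlacing roots\<close>

abbreviation root_prod :: "real set \<Rightarrow> real poly" where
  "root_prod S \<equiv> (\<Prod>x\<in>S. [:- x, 1:])"

lemma poly_root_prod_eq_0: "finite S \<Longrightarrow> poly (root_prod S) x = 0 \<longleftrightarrow> x \<in> S"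
  by (auto simp: poly_prod)

lemma degree_root_prod: "degree (root_prod S) = card S"
  by (cases "finite S") (auto simp: degree_prod_eq_sum_degree)

lemma monic_root_prod: "lead_coeff (root_prod S) = 1"
  by (rule monic_prod) auto

lemma sgn_poly_root_prod:
  assumes "finite S" "x \<notin> S"
  shows "0 < (- 1) ^ card {s \<in> S. x < s} * poly (root_prod S) x"
  using assms
proof (induction S)
  case empty
  then show ?case by simp
next
  case (insert s S)
  have IH: "0 < (- 1) ^ card {r \<in> S. x < r} * poly (root_prod S) x"
    using insert by auto
  show ?case
  proof (cases "x < s")
    case True
    then have "{r \<in> insert s S. x < r} = insert s {r \<in> S. x < r}" by auto
    then have "card {r \<in> insert s S. x < r} = Suc (card {r \<in> S. x < r})"
      using insert by simp
    then show ?thesis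
      using insert mult_pos_pos[OF IH, of "s - x"] True by (simp add: algebra_simps)
  next
    case False
    then have "{r \<in> insert s S. x < r} = {r \<in> S. x < r}" by auto
    then show ?thesis
      using insert mult_pos_pos[OF IH, of "x - s"] False by (simp add: algebra_simps)
  qed
qed

lemma poly_pderiv_root_prod:
  assumes "finite S" "x \<in> S"
  shows "poly (pderiv (root_prod S)) x = poly (root_prod (S - {x})) x"
proof -
  have "root_prod S = [:- x, 1:] * root_prod (S - {x})"
    using assms by (rule prod.remove)
  then have "pderiv (root_prod S) = pderiv ([:- x, 1:] * root_prod (S - {x}))" by simp
  then show ?thesis by (simp only: pderiv_mult) (simp add: pderiv_pCons)
qed

lemma monic_eq_root_prod:
  assumes "lead_coeff p = 1" "finite T" "card T = degree p" "\<And>x. x \<in> T \<Longrightarrow> poly p x = 0"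
  shows "p = root_prod T"
proof (rule ccontr)
  assume ne: "p \<noteq> root_prod T"
  let ?r = "p - root_prod T"
  have r0: "?r \<noteq> 0" using ne by simp
  have "T \<subseteq> {x. poly ?r x = 0}"
    using assms by (auto simp: poly_root_prod_eq_0)
  then have "card T \<le> card {x. poly ?r x = 0}"
    using r0 poly_roots_finite card_mono by blast
  also have "\<dots> \<le> degree ?r" using r0 by (rule card_poly_roots_bound)
  finally have le: "degree p \<le> degree ?r" using assms(3) by simp
  have "degree ?r \<le> degree p"
    using assms(3) degree_root_prod[of T] by (intro degree_diff_le) auto
  with le have "degree ?r = degree p" by simp
  moreover have "coeff ?r (degree p) = 0"
    using assms(1,3) monic_root_prod[of T] degree_root_prod[of T] by simp
  ultimately show False using r0 leading_coeff_0_iff by metis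
qed

lemma decreasing_enumeration:
  fixes S :: "real set"
  assumes "finite S"
  obtains f where "bij_betw f {..<card S} S" "\<And>i j. i < j \<Longrightarrow> j < card S \<Longrightarrow> f j < f i"
proof -
  let ?xs = "rev (sorted_list_of_set S)"
  have "bij_betw ((!) ?xs) {..<card S} S"
    using assms by (intro bij_betw_nth) auto
  moreover have "sorted_wrt (>) ?xs"
    by (simp add: sorted_wrt_rev)
  then have "?xs ! j < ?xs ! i" if "i < j" "j < card S" for i j
    using that sorted_wrt_nth_less[of "(>)" ?xs i j] by simp
  ultimately show ?thesis using that by blast
qed

lemma alternating_values_roots:
  fixes p :: "real poly"
  assumes dec: "\<And>l. l < n \<Longrightarrow> y (Suc l) < y l"
    and sg: "\<And>l. l \<le> n \<Longrightarrow> 0 < (- 1) ^ l * poly p (y l)"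
  obtains \<tau> where "\<And>l. l < n \<Longrightarrow> y (Suc l) < \<tau> l \<and> \<tau> l < y l \<and> poly p (\<tau> l) = 0"
proof -
  have "\<exists>x. y (Suc l) < x \<and> x < y l \<and> poly p x = 0" if "l < n" for l
  proof -
    have a: "0 < (- 1) ^ l * poly p (y l)" "0 < - ((- 1) ^ l * poly p (y (Suc l)))"
      using sg[of l] sg[of "Suc l"] that by auto
    then have "0 < ((- 1) ^ l * poly p (y l)) * (- ((- 1) ^ l * poly p (y (Suc l))))"
      by (rule mult_pos_pos)
    then have "poly p (y (Suc l)) * poly p (y l) < 0"
      by (cases "even l") (auto simp: mult_less_0_iff zero_less_mult_iff)
    then show ?thesis using poly_IVT[OF dec[OF that]] by auto
  qed
  then show ?thesis using that by metis
qed

lemma monic_poly_signs_at_infinity: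
  fixes p :: "real poly"
  assumes "lead_coeff p = 1"
  obtains M where "\<And>x. x \<ge> M \<Longrightarrow> 0 < poly p x" "\<And>x. x \<ge> M \<Longrightarrow> 0 < (- 1) ^ degree p * poly p (- x)"
proof -
  obtain M1 where M1: "\<And>x. x \<ge> M1 \<Longrightarrow> 1 \<le> poly p x"
    using poly_pinfty_gt_lc[of p] assms by auto
  let ?q = "Polynomial.smult ((- 1) ^ degree p) (pcompose p [:0, - 1:])"
  have "lead_coeff ?q = 1"
    using assms lead_coeff_comp[of "[:0, - 1:]" p]
    by (simp add: lead_coeff_smult flip: power_mult_distrib)
  then obtain M2 where M2: "\<And>x. x \<ge> M2 \<Longrightarrow> 1 \<le> poly ?q x"
    using poly_pinfty_gt_lc[of ?q] by auto
  show ?thesis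
  proof (rule that[of "max M1 M2"])
    show "0 < poly p x" if "x \<ge> max M1 M2" for x using M1[of x] that by simp
    show "0 < (- 1) ^ degree p * poly p (- x)" if "x \<ge> max M1 M2" for x
      using M2[of x] that by (simp add: poly_pcompose)
  qed
qed

text \<open>The sign condition says that the partial fraction expansion of \<open>q / p\<close> has
  positive residues.\<close>

definition interlaces :: "real poly \<Rightarrow> real poly \<Rightarrow> bool" where
  "interlaces q p \<longleftrightarrow> p = root_prod {x. poly p x = 0} \<and> finite {x. poly p x = 0} \<and>
     degree q \<le> degree p \<and> (\<forall>x. poly p x = 0 \<longrightarrow> 0 < poly q x * poly (pderiv p) x)"

definition roots_above :: "real poly \<Rightarrow> real \<Rightarrow> nat" where
  "roots_above p t = card {x. poly p x = 0 \<and> t < x}"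

lemma interlaces_step:
  fixes a :: real
  assumes "interlaces q p"
  defines "h \<equiv> [:- a, 1:] * p - q"
  shows "interlaces p h" "degree h = Suc (degree p)" "roots_above p t \<le> roots_above h t"
proof -
  define S where "S = {x. poly p x = 0}"
  have S: "finite S" "p = root_prod S" and dq: "degree q \<le> degree p"
    and pos: "\<And>x. x \<in> S \<Longrightarrow> 0 < poly q x * poly (pderiv p) x"
    using assms(1) unfolding interlaces_def S_def by auto
  define n where "n = degree p"
  have n: "n = card S" using S(2) degree_root_prod[of S] by (simp add: n_def)
  have lp: "lead_coeff p = 1" using S(2) monic_root_prod[of S] by simp
  then have p0: "p \<noteq> 0" by auto
  have dap: "degree ([:- a, 1:] * p) = Suc n"
    using p0 by (subst degree_mult_eq) (auto simp: n_def)
  have dh: "degree h = Suc n"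
    unfolding h_def diff_conv_add_uminus using dap dq n_def
    by (subst degree_add_eq_left) auto
  then show "degree h = Suc (degree p)" by (simp add: n_def)
  have lh: "lead_coeff h = 1"
  proof -
    have "coeff q (Suc n) = 0" using dq n_def by (intro coeff_eq_0) auto
    moreover have "coeff ([:- a, 1:] * p) (Suc n) = 1"
      using lead_coeff_mult[of "[:- a, 1:]" p] dap lp by simp
    ultimately show ?thesis unfolding dh by (simp add: h_def)
  qed
  obtain \<alpha> where \<alpha>: "bij_betw \<alpha> {..<n} S" "\<And>i j. i < j \<Longrightarrow> j < n \<Longrightarrow> \<alpha> j < \<alpha> i"
    using decreasing_enumeration[OF S(1)] n by metis
  obtain M0 where M0: "\<And>x. x \<ge> M0 \<Longrightarrow> 0 < poly h x"
      "\<And>x. x \<ge> M0 \<Longrightarrow> 0 < (- 1) ^ degree h * poly h (- x)"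
    using monic_poly_signs_at_infinity[OF lh] by metis
  define M where "M = Max (insert 1 (insert M0 ((\<lambda>x. \<bar>x\<bar> + 1) ` S)))"
  have M: "M0 \<le> M" "1 \<le> M" "\<And>x. x \<in> S \<Longrightarrow> \<bar>x\<bar> + 1 \<le> M"
    unfolding M_def using S(1) by (intro Max_ge; simp)+
  have \<alpha>S: "\<alpha> l \<in> S" if "l < n" for l using \<alpha>(1) that by (auto simp: bij_betw_def)
  have \<alpha>M: "\<alpha> l < M \<and> - M < \<alpha> l" if "l < n" for l
    using M(3)[OF \<alpha>S[OF that]] by linarith
  define y where "y l = (if l = 0 then M else if l = Suc n then - M else \<alpha> (l - 1))" for l
  have y_simps: "y 0 = M" "y (Suc n) = - M" "\<And>l. l < n \<Longrightarrow> y (Suc l) = \<alpha> l"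
    by (auto simp: y_def)
  have dec: "y (Suc l) < y l" if l: "l < Suc n" for l
  proof -
    consider "l = 0" "n = 0" | "l = 0" "n > 0" | "0 < l" "l = n" | "0 < l" "l < n"
      using l by (metis gr0I less_SucE)
    then show ?thesis
      using M(2) \<alpha>M[of 0] \<alpha>M[of "n - 1"] \<alpha>(2)[of "l - 1" l] by cases (auto simp: y_def)
  qed
  have ymono: "y j \<le> y i" if "i \<le> j" "j \<le> Suc n" for i j
    using that
  proof (induction j rule: dec_induct)
    case (step m)
    then show ?case using dec[of m] by auto
  qed simp
  have card\<alpha>: "card {s \<in> S. x < s} = l"
    if "y (Suc l) \<le> x" "x < y l" "l \<le> n" for l x
  proof -
    have "{s \<in> S. x < s} = \<alpha> ` {..<l}"
    proof (intro equalityI subsetI)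
      fix s assume "s \<in> {s \<in> S. x < s}"
      then obtain m where m: "m < n" "s = \<alpha> m" "x < \<alpha> m"
        using \<alpha>(1) by (auto simp: bij_betw_def)
      have "m < l"
      proof (rule ccontr)
        assume "\<not> m < l"
        then have "y (Suc m) \<le> y (Suc l)" using m by (intro ymono) auto
        then show False using m that y_simps(3)[of m] by linarith
      qed
      then show "s \<in> \<alpha> ` {..<l}" using m by auto
    next
      fix s assume "s \<in> \<alpha> ` {..<l}"
      then obtain m where m: "m < l" "s = \<alpha> m" by auto
      then have "y l \<le> y (Suc m)" using that by (intro ymono) auto
      then have "x < s" using m that y_simps(3)[of m] by simp
      then show "s \<in> {s \<in> S. x < s}" using m \<alpha>S[of m] that by auto
    qed
    moreover have "inj_on \<alpha> {..<l}"
      using \<alpha>(1) that(3) by (auto simp: bij_betw_def intro: inj_on_subset)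
    ultimately show ?thesis by (simp add: card_image)
  qed
  have sg: "0 < (- 1) ^ l * poly h (y l)" if l: "l \<le> Suc n" for l
  proof -
    consider "l = 0" | "l = Suc n" | m where "l = Suc m" "m < n"
      using l by (metis Suc_less_eq le_neq_implies_less not0_implies_Suc)
    then show ?thesis
    proof cases
      case 1
      then show ?thesis using M0(1) M(1) y_simps by simp
    next
      case 2
      then show ?thesis using M0(2)[OF M(1)] y_simps dh by simp
    next
      case 3
      let ?x = "\<alpha> m"
      have x: "?x \<in> S" using \<alpha>S 3 by simp
      have hx: "poly h ?x = - poly q ?x" using x by (simp add: h_def S_def)
      have c: "card {s \<in> S. ?x < s} = m"
        using 3 card\<alpha>[of m ?x] y_simps(3)[of m] dec[of m] by simp
      have "{s \<in> S - {?x}. ?x < s} = {s \<in> S. ?x < s}" by auto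
      then have "0 < (- 1) ^ m * poly (root_prod (S - {?x})) ?x"
        using sgn_poly_root_prod[of "S - {?x}" ?x] S(1) c by simp
      then have s1: "0 < (- 1) ^ m * poly (pderiv p) ?x"
        using poly_pderiv_root_prod[OF S(1) x] S(2) by simp
      then have "0 < (- 1) ^ m * poly q ?x"
        using pos[OF x] by (cases "even m") (auto simp: zero_less_mult_iff)
      then show ?thesis using 3 hx y_simps(3)[of m] by simp
    qed
  qed
  obtain \<tau> where \<tau>: "\<And>l. l < Suc n \<Longrightarrow> y (Suc l) < \<tau> l \<and> \<tau> l < y l \<and> poly h (\<tau> l) = 0"
    using alternating_values_roots[where n = "Suc n" and y = y and p = h] dec sg by metis
  have \<tau>dec: "\<tau> j < \<tau> i" if "i < j" "j < Suc n" for i j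
    using \<tau>[of i] \<tau>[of j] ymono[of "Suc i" j] that by auto
  then have \<tau>less: "\<tau> j < \<tau> i \<longleftrightarrow> i < j" if "i < Suc n" "j < Suc n" for i j
    using that by (metis linorder_neqE_nat not_less_iff_gr_or_eq)
  have inj: "inj_on \<tau> {..<Suc n}"
    using \<tau>less by (intro inj_onI) (metis lessThan_iff less_irrefl linorder_neqE_nat)
  define T where "T = \<tau> ` {..<Suc n}"
  have T: "finite T" "card T = Suc n" using inj by (auto simp: T_def card_image)
  have hT: "h = root_prod T"
    using lh T dh \<tau> by (intro monic_eq_root_prod) (auto simp: T_def)
  have Troots: "{x. poly h x = 0} = T"
    using hT poly_root_prod_eq_0[OF T(1)] by auto
  have "0 < poly p x * poly (pderiv h) x" if x: "x \<in> T" for x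
  proof -
    obtain l where l: "l < Suc n" "x = \<tau> l" using x by (auto simp: T_def)
    have xS: "x \<notin> S"
    proof
      assume "x \<in> S"
      then obtain m where m: "m < n" "x = y (Suc m)"
        using \<alpha>(1) y_simps by (auto simp: bij_betw_def)
      show False
        using m l \<tau>[of l] ymono[of "Suc m" l] ymono[of "Suc l" "Suc m"]
        by (cases "m < l") auto
    qed
    have "{m. m < Suc n \<and> \<tau> l < \<tau> m} = {..<l}" using l \<tau>less by auto
    moreover have "{s \<in> T - {x}. x < s} = \<tau> ` {m. m < Suc n \<and> \<tau> l < \<tau> m}"
      using l by (auto simp: T_def)
    moreover have "inj_on \<tau> {..<l}" using inj l by (auto intro: inj_on_subset)
    ultimately have "card {s \<in> T - {x}. x < s} = l" by (simp add: card_image)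
    then have "0 < (- 1) ^ l * poly (pderiv h) x"
      using sgn_poly_root_prod[of "T - {x}" x] T(1) poly_pderiv_root_prod[OF T(1) x] hT by simp
    moreover have "0 < (- 1) ^ l * poly p x"
      using sgn_poly_root_prod[OF S(1) xS] card\<alpha>[of l x] l \<tau>[of l] S(2) by simp
    ultimately show ?thesis by (cases "even l") (auto simp: zero_less_mult_iff)
  qed
  then show "interlaces p h"
    unfolding interlaces_def Troots using hT T dh n_def Troots by auto
  show "roots_above p t \<le> roots_above h t"
  proof -
    have "card (\<alpha> ` {l. l < n \<and> t < \<alpha> l}) = card {l. l < n \<and> t < \<alpha> l}"
      using \<alpha>(1) by (intro card_image) (auto simp: bij_betw_def intro: inj_on_subset)
    moreover have "{x. poly p x = 0 \<and> t < x} = {x \<in> \<alpha> ` {..<n}. t < x}"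
      using \<alpha>(1) unfolding bij_betw_def S_def by simp
    then have "{x. poly p x = 0 \<and> t < x} = \<alpha> ` {l. l < n \<and> t < \<alpha> l}"
      by auto
    moreover have "card (\<tau> ` {l. l < n \<and> t < \<alpha> l}) = card {l. l < n \<and> t < \<alpha> l}"
      using inj by (intro card_image) (auto intro: inj_on_subset)
    moreover have "card (\<tau> ` {l. l < n \<and> t < \<alpha> l}) \<le> card {x. poly h x = 0 \<and> t < x}"
    proof (rule card_mono)
      show "finite {x. poly h x = 0 \<and> t < x}"
        using T(1) Troots by (auto intro: finite_subset[of _ T])
      show "\<tau> ` {l. l < n \<and> t < \<alpha> l} \<subseteq> {x. poly h x = 0 \<and> t < x}"
      proof (safe)
        fix l assume "l < n" "t < \<alpha> l"
        then show "poly h (\<tau> l) = 0" "t < \<tau> l"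
          using \<tau>[of l] y_simps(3)[of l] by auto
      qed
    qed
    ultimately show ?thesis by (simp add: roots_above_def)
  qed
qed

lemma interlaces_smult: "interlaces q p \<Longrightarrow> 0 < c \<Longrightarrow> interlaces (Polynomial.smult c q) p"
  by (auto simp: interlaces_def mult.assoc)

text \<open>If \<open>p1\<close> and \<open>p2\<close> share roots, their gcd \<open>g\<close> divides \<open>h\<close>, and \<open>h / g\<close> arises by a single
  interlacing step from the squarefree product of the roots of \<open>p1\<close> and \<open>p2\<close>.\<close>

lemma interlaces_combine:
  fixes a :: real
  assumes "interlaces q1 p1" "interlaces q2 p2"
    and h: "h = [:- a, 1:] * p1 * p2 - q1 * p2 - p1 * q2"
    and "interlaces r h"
  shows "roots_above p1 t + roots_above p2 t \<le> roots_above h t"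
proof -
  define A where "A = {x. poly p1 x = 0}"
  define B where "B = {x. poly p2 x = 0}"
  have A: "finite A" "p1 = root_prod A" "degree q1 \<le> degree p1"
      "\<And>x. x \<in> A \<Longrightarrow> 0 < poly q1 x * poly (pderiv p1) x"
    and B: "finite B" "p2 = root_prod B" "degree q2 \<le> degree p2"
      "\<And>x. x \<in> B \<Longrightarrow> 0 < poly q2 x * poly (pderiv p2) x"
    using assms(1,2) unfolding interlaces_def A_def B_def by auto
  define g where "g = root_prod (A \<inter> B)"
  define u where "u = root_prod (A - B)"
  define v where "v = root_prod (B - A)"
  have p1: "p1 = g * u" unfolding A(2) g_def u_def
    using A(1) by (subst prod.union_disjoint[symmetric]) (auto intro!: prod.cong)
  have p2: "p2 = g * v" unfolding B(2) g_def v_def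
    using B(1) by (subst prod.union_disjoint[symmetric]) (auto intro!: prod.cong)
  have p1v: "root_prod (A \<union> B) = p1 * v" unfolding A(2) v_def
    using A(1) B(1) by (subst prod.union_disjoint[symmetric]) (auto intro!: prod.cong)
  have p2u: "root_prod (A \<union> B) = p2 * u" unfolding B(2) u_def
    using A(1) B(1) by (subst prod.union_disjoint[symmetric]) (auto intro!: prod.cong)
  have v0: "poly v x = 0 \<longleftrightarrow> x \<in> B - A" and u0: "poly u x = 0 \<longleftrightarrow> x \<in> A - B"
    and g0: "poly g x = 0 \<longleftrightarrow> x \<in> A \<inter> B" for x
    unfolding u_def v_def g_def using A(1) B(1) by (auto simp: poly_root_prod_eq_0)
  define q where "q = q1 * v + q2 * u"
  define k where "k = [:- a, 1:] * root_prod (A \<union> B) - q"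
  have hgk: "h = g * k"
    unfolding h k_def q_def p1v by (simp add: p1 p2 algebra_simps)
  have AB_roots: "{x. poly (root_prod (A \<union> B)) x = 0} = A \<union> B"
    using A(1) B(1) poly_root_prod_eq_0[of "A \<union> B"] by auto
  have "interlaces q (root_prod (A \<union> B))"
    unfolding interlaces_def AB_roots
  proof (intro conjI allI impI)
    show "finite (A \<union> B)" using A B by simp
    have "degree (q1 * v) \<le> degree (root_prod (A \<union> B))"
    proof -
      have "degree (q1 * v) \<le> degree q1 + degree v" by (rule degree_mult_le)
      also have "\<dots> \<le> degree p1 + degree v" using A by simp
      also have "\<dots> = card A + card (B - A)"
        unfolding A(2) v_def degree_root_prod ..
      also have "\<dots> = card (A \<union> (B - A))"
        using A B by (intro card_Un_disjoint[symmetric]) auto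
      finally show ?thesis unfolding degree_root_prod by simp
    qed
    moreover have "degree (q2 * u) \<le> degree (root_prod (A \<union> B))"
    proof -
      have "degree (q2 * u) \<le> degree q2 + degree u" by (rule degree_mult_le)
      also have "\<dots> \<le> degree p2 + degree u" using B by simp
      also have "\<dots> = card B + card (A - B)"
        unfolding B(2) u_def degree_root_prod ..
      also have "\<dots> = card (B \<union> (A - B))"
        using A B by (intro card_Un_disjoint[symmetric]) auto
      finally show ?thesis unfolding degree_root_prod by (simp add: Un_commute)
    qed
    ultimately show "degree q \<le> degree (root_prod (A \<union> B))"
      unfolding q_def by (intro degree_add_le)
    fix x assume "poly (root_prod (A \<union> B)) x = 0"
    then have x: "x \<in> A \<or> x \<in> B" using AB_roots by auto
    have sq: "0 < a * b * (c * c)" if "0 < a * b" "c \<noteq> 0" for a b c :: real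
      using that not_real_square_gt_zero[of c] by (metis mult_pos_pos)
    have dA: "poly (pderiv (root_prod (A \<union> B))) x = poly (pderiv p1) x * poly v x" if "x \<in> A"
      unfolding p1v using that A(2) poly_root_prod_eq_0[OF A(1)] by (simp add: pderiv_mult)
    have dB: "poly (pderiv (root_prod (A \<union> B))) x = poly (pderiv p2) x * poly u x" if "x \<in> B"
      unfolding p2u using that B(2) poly_root_prod_eq_0[OF B(1)] by (simp add: pderiv_mult)
    consider "x \<in> A" "x \<notin> B" | "x \<in> B" "x \<notin> A" | "x \<in> A" "x \<in> B" using x by auto
    then show "0 < poly q x * poly (pderiv (root_prod (A \<union> B))) x"
    proof cases
      case 1
      then show ?thesis
        using sq[OF A(4)[of x], of "poly v x"] u0[of x] v0[of x]
        by (simp add: dA q_def algebra_simps)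
    next
      case 2
      then show ?thesis
        using sq[OF B(4)[of x], of "poly u x"] u0[of x] v0[of x]
        by (simp add: dB q_def algebra_simps)
    next
      case 3
      have "0 < poly q1 x * poly (pderiv p1) x * (poly v x * poly v x) +
        poly q2 x * poly (pderiv p2) x * (poly u x * poly u x)"
        using 3 u0[of x] v0[of x] by (intro add_pos_pos sq A(4) B(4)) auto
      also have "\<dots> = poly q1 x * poly v x * poly (pderiv (root_prod (A \<union> B))) x +
         poly q2 x * poly u x * poly (pderiv (root_prod (A \<union> B))) x"
        by (subst dA[OF 3(1)], subst dB[OF 3(2)]) (simp add: algebra_simps)
      finally show ?thesis by (simp add: q_def algebra_simps)
    qed
  qed simp
  note step = interlaces_step[OF this, where a = a, folded k_def]
  have fk: "finite {x. poly k x = 0}" using step(1) by (simp add: interlaces_def)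
  have disj: "poly g x \<noteq> 0 \<or> poly k x \<noteq> 0" for x
  proof (rule ccontr)
    assume "\<not> ?thesis"
    then have "poly h x = 0" "poly (pderiv h) x = 0" by (simp_all add: hgk pderiv_mult)
    then show False using assms(4) unfolding interlaces_def by force
  qed
  have fin: "finite (A \<inter> {t<..})" "finite (B \<inter> {t<..})" using A B by auto
  have "roots_above p1 t + roots_above p2 t = card (A \<inter> {t<..}) + card (B \<inter> {t<..})"
    unfolding roots_above_def A_def B_def by (auto intro!: arg_cong2[of _ _ _ _ "(+)"] arg_cong[of _ _ card])
  also have "\<dots> = card ((A \<inter> {t<..}) \<union> (B \<inter> {t<..})) + card ((A \<inter> {t<..}) \<inter> (B \<inter> {t<..}))"
    using fin by (rule card_Un_Int)
  also have "(A \<inter> {t<..}) \<union> (B \<inter> {t<..}) = {x. poly (root_prod (A \<union> B)) x = 0 \<and> t < x}"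
    using AB_roots by auto
  also have "(A \<inter> {t<..}) \<inter> (B \<inter> {t<..}) = {x. poly g x = 0 \<and> t < x}"
    using g0 by auto
  also have "card {x. poly (root_prod (A \<union> B)) x = 0 \<and> t < x} + card {x. poly g x = 0 \<and> t < x}
      \<le> card {x. poly k x = 0 \<and> t < x} + card {x. poly g x = 0 \<and> t < x}"
    using step(3)[of t] by (simp add: roots_above_def)
  also have "\<dots> = card ({x. poly k x = 0 \<and> t < x} \<union> {x. poly g x = 0 \<and> t < x})"
    using disj fk A(1) by (intro card_Un_disjoint[symmetric]) (auto simp: g0)
  also have "{x. poly k x = 0 \<and> t < x} \<union> {x. poly g x = 0 \<and> t < x} = {x. poly h x = 0 \<and> t < x}"
    by (auto simp: hgk)
  finally show ?thesis by (simp add: roots_above_def)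
qed

text \<open>The index is shifted by one: \<open>continuant a c (Suc n)\<close> has degree \<open>n\<close>, and \<open>c 0\<close> is irrelevant
  because it multiplies \<open>0\<close>.\<close>

fun continuant :: "(nat \<Rightarrow> real) \<Rightarrow> (nat \<Rightarrow> real) \<Rightarrow> nat \<Rightarrow> real poly" where
  "continuant a c 0 = 0"
| "continuant a c (Suc 0) = 1"
| "continuant a c (Suc (Suc n)) =
     [:- a n, 1:] * continuant a c (Suc n) - Polynomial.smult (c n) (continuant a c n)"

lemma interlaces_continuant:
  assumes "\<And>m. 0 < m \<Longrightarrow> m \<le> n \<Longrightarrow> 0 < c m"
  shows "interlaces (Polynomial.smult (c n) (continuant a c n)) (continuant a c (Suc n))"
    and "degree (continuant a c (Suc n)) = n"
  using assms
proof (induction n)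
  case 0
  case 1 show ?case by (simp add: interlaces_def)
  case 2 show ?case by simp
next
  case (Suc n)
  case 1
  then show ?case
    using Suc.IH(1) interlaces_step(1)[of _ "continuant a c (Suc n)" "a n"]
    by (auto intro!: interlaces_smult)
  case 2
  then show ?case
    using Suc.IH interlaces_step(2)[of _ "continuant a c (Suc n)" "a n"] by simp
qed

lemma interlaces_continuant_last:
  assumes "\<And>m. 0 < m \<Longrightarrow> m \<le> n \<Longrightarrow> 0 < c m"
  shows "interlaces (continuant a c (Suc n)) (continuant a c (Suc (Suc n)))"
    and "degree (continuant a c (Suc (Suc n))) = Suc n"
    and "roots_above (continuant a c (Suc n)) t \<le> roots_above (continuant a c (Suc (Suc n))) t"
  using interlaces_step[OF interlaces_continuant(1)[of n c a], where a = "a n"]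
    interlaces_continuant(2)[of n c a] assms
  by simp_all

lemma roots_above_continuant_mono:
  assumes "\<And>m. 0 < m \<Longrightarrow> m < n \<Longrightarrow> 0 < c m" "i \<le> n"
  shows "roots_above (continuant a c (Suc i)) t \<le> roots_above (continuant a c (Suc n)) t"
  using assms(2,1)
proof (induction n rule: dec_induct)
  case (step n)
  have "roots_above (continuant a c (Suc n)) t \<le> roots_above (continuant a c (Suc (Suc n))) t"
    using step.prems by (intro interlaces_continuant_last(3)) auto
  then show ?case using step by force
qed simp

lemma continuant_split:
  assumes "\<And>m. m \<le> d \<Longrightarrow> a' m = a (d - m)" "\<And>m. m \<le> d \<Longrightarrow> c' m = c (Suc d - m)"
  shows "k \<le> d \<Longrightarrow> continuant a c (Suc (Suc d)) =
    continuant a c (Suc (Suc (d - k))) * continuant a' c' (Suc k) -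
    Polynomial.smult (c (Suc (d - k))) (continuant a c (Suc (d - k)) * continuant a' c' k)"
proof (induction k)
  case (Suc k)
  define m where "m = d - Suc k"
  have m: "d - k = Suc m" "d - Suc k = m" "Suc d - k = Suc (Suc m)" using Suc.prems by (auto simp: m_def)
  have "a' k = a (Suc m)" "c' k = c (Suc (Suc m))" using assms[of k] m Suc.prems by auto
  moreover have "continuant a c (Suc (Suc d)) =
    continuant a c (Suc (Suc (Suc m))) * continuant a' c' (Suc k) -
    Polynomial.smult (c (Suc (Suc m))) (continuant a c (Suc (Suc m)) * continuant a' c' k)"
    using Suc m by simp
  ultimately show ?case unfolding m
    by (simp add: algebra_simps smult_diff_right smult_add_right del: mult_pCons_left mult_pCons_right)
qed simp

section \<open>Newton expansions\<close>

definition newton_basis :: "(nat \<Rightarrow> real) \<Rightarrow> nat \<Rightarrow> real poly" where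
  "newton_basis \<nu> r = (\<Prod>s<r. [:- \<nu> s, 1:])"

lemma newton_basis_Suc: "newton_basis \<nu> (Suc r) = newton_basis \<nu> r * [:- \<nu> r, 1:]"
  by (simp add: newton_basis_def)

lemma degree_newton_basis: "degree (newton_basis \<nu> r) = r"
  by (simp add: newton_basis_def degree_prod_eq_sum_degree)

lemma lead_coeff_newton_basis: "coeff (newton_basis \<nu> r) r = 1"
proof -
  have "lead_coeff (newton_basis \<nu> r) = 1"
    unfolding newton_basis_def by (rule monic_prod) auto
  then show ?thesis by (simp add: degree_newton_basis)
qed

lemma poly_newton_basis_eq_0: "poly (newton_basis \<nu> r) x = 0 \<longleftrightarrow> x \<in> \<nu> ` {..<r}"
  by (auto simp: newton_basis_def poly_prod)

lemma newton_basis_independent: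
  assumes "(\<Sum>r\<le>n. Polynomial.smult (e r) (newton_basis \<nu> r)) = 0" "r \<le> n"
  shows "e r = 0"
  using assms
proof (induction n)
  case 0
  then show ?case by (simp add: newton_basis_def)
next
  case (Suc n)
  have "coeff (newton_basis \<nu> s) (Suc n) = 0" if "s \<le> n" for s
    using that by (intro coeff_eq_0) (simp add: degree_newton_basis)
  then have "coeff (\<Sum>r\<le>Suc n. Polynomial.smult (e r) (newton_basis \<nu> r)) (Suc n) = e (Suc n)"
    by (simp add: coeff_sum lead_coeff_newton_basis)
  with Suc.prems(1) have "e (Suc n) = 0" by simp
  with Suc show ?case by (cases "r = Suc n") auto
qed

lemma newton_basis_unique:
  assumes "(\<Sum>r\<le>n. Polynomial.smult (e r) (newton_basis \<nu> r)) =
    (\<Sum>r\<le>n. Polynomial.smult (f r) (newton_basis \<nu> r))" "r \<le> n"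
  shows "e r = f r"
proof -
  have "(\<Sum>r\<le>n. Polynomial.smult (e r - f r) (newton_basis \<nu> r)) = 0"
    using assms(1) by (simp add: smult_diff_left sum_subtractf)
  from newton_basis_independent[OF this assms(2)] show ?thesis by simp
qed

text \<open>Multiplying a Newton expansion of degree \<open>m\<close> by
  \<open>X - x = (X - \<nu> r) + (\<nu> r - x)\<close> keeps the coefficients nonnegative since
  \<open>x \<le> \<nu> m \<le> \<nu> r\<close> for \<open>r \<le> m\<close>.\<close>

lemma newton_coeffs_nonneg:
  assumes "\<And>i j. i \<le> j \<Longrightarrow> j < n \<Longrightarrow> \<nu> j \<le> \<nu> i" "length xs \<le> n"
    and "\<And>s. s < length xs \<Longrightarrow> xs ! s \<le> \<nu> s"
  shows "\<exists>c. (\<forall>r. 0 \<le> c r) \<and> (\<forall>r > length xs. c r = 0) \<and>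
    (\<Prod>x\<leftarrow>xs. [:- x, 1:]) = (\<Sum>r\<le>length xs. Polynomial.smult (c r) (newton_basis \<nu> r))"
  using assms(2,3)
proof (induction xs rule: rev_induct)
  case Nil
  then show ?case
    by (intro exI[of _ "\<lambda>r. if r = 0 then 1 else 0"]) (auto simp: newton_basis_def)
next
  case (snoc x xs)
  let ?m = "length xs"
  have "xs ! s \<le> \<nu> s" if "s < ?m" for s
    using snoc.prems(2)[of s] that by (simp add: nth_append)
  then obtain c where c: "\<And>r. 0 \<le> c r" "\<And>r. r > ?m \<Longrightarrow> c r = 0"
      "(\<Prod>x\<leftarrow>xs. [:- x, 1:]) = (\<Sum>r\<le>?m. Polynomial.smult (c r) (newton_basis \<nu> r))"
    using snoc.IH snoc.prems(1) by auto
  have x: "x \<le> \<nu> r" if "r \<le> ?m" for r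
    using snoc.prems(2)[of ?m] snoc.prems(1) assms(1)[OF that] by simp
  define c' where "c' r = (if r = 0 then 0 else c (r - 1)) + c r * (\<nu> r - x)" for r
  have nonneg: "0 \<le> c' r" for r
    using c(1)[of "r - 1"] c(1)[of r] c(2)[of r] x[of r]
    by (cases "r \<le> ?m") (auto simp: c'_def)
  have zero: "c' r = 0" if "r > length (xs @ [x])" for r
    using that c(2) by (simp add: c'_def)
  have "(\<Prod>x\<leftarrow>xs @ [x]. [:- x, 1:]) =
      (\<Sum>r\<le>?m. Polynomial.smult (c r) (newton_basis \<nu> r)) * [:- x, 1:]"
    by (simp only: map_append prod_list.append c(3)) simp
  also have "\<dots> = (\<Sum>r\<le>?m. Polynomial.smult (c r) (newton_basis \<nu> (Suc r)) +
      Polynomial.smult (c r * (\<nu> r - x)) (newton_basis \<nu> r))"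
    unfolding sum_distrib_right newton_basis_Suc
    by (intro sum.cong refl) (simp add: algebra_simps smult_diff_left smult_diff_right)
  also have "\<dots> = (\<Sum>r\<le>Suc ?m. Polynomial.smult (if r = 0 then 0 else c (r - 1)) (newton_basis \<nu> r)) +
      (\<Sum>r\<le>Suc ?m. Polynomial.smult (c r * (\<nu> r - x)) (newton_basis \<nu> r))"
    unfolding sum.distrib by (subst sum.atMost_Suc_shift) (simp add: c(2))
  also have "\<dots> = (\<Sum>r\<le>length (xs @ [x]). Polynomial.smult (c' r) (newton_basis \<nu> r))"
    by (simp add: c'_def smult_add_left sum.distrib)
  finally show ?case using nonneg zero by (intro exI[of _ c']) blast
qed

lemma sorted_nth_le_if_count_le:
  fixes xs :: "real list"
  assumes "sorted_wrt (\<ge>) xs" "\<And>i j. i \<le> j \<Longrightarrow> j < n \<Longrightarrow> \<nu> j \<le> \<nu> i"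
    and "\<And>t. length (filter (\<lambda>x. t < x) xs) \<le> card {s. s < n \<and> t < \<nu> s}"
    and "s < length xs" "s < n"
  shows "xs ! s \<le> \<nu> s"
proof (rule ccontr)
  assume less: "\<not> xs ! s \<le> \<nu> s"
  have "card {..s} \<le> card {i. i < length xs \<and> \<nu> s < xs ! i}"
  proof (intro card_mono subsetI)
    fix i assume "i \<in> {..s}"
    then have "xs ! s \<le> xs ! i"
      using sorted_wrt_nth_less[OF assms(1), of i s] assms(4) by (cases "i = s") auto
    then show "i \<in> {i. i < length xs \<and> \<nu> s < xs ! i}"
      using less \<open>i \<in> {..s}\<close> assms(4) by auto
  qed auto
  also have "\<dots> \<le> card {r. r < n \<and> \<nu> s < \<nu> r}"
    using assms(3)[of "\<nu> s"] by (simp add: length_filter_conv_card)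
  also have "\<dots> \<le> card {..<s}"
  proof (intro card_mono subsetI)
    fix r assume "r \<in> {r. r < n \<and> \<nu> s < \<nu> r}"
    then show "r \<in> {..<s}" using assms(2)[of s r] by (cases "s \<le> r") auto
  qed simp
  finally show False by simp
qed

lemma newton_coeffs_nonneg_product:
  assumes "interlaces q1 p1" "interlaces q2 p2"
    and "\<And>i j. i \<le> j \<Longrightarrow> j \<le> d \<Longrightarrow> \<nu> j \<le> \<nu> i" "degree p1 + degree p2 \<le> d"
    and "\<And>t. roots_above p1 t + roots_above p2 t \<le> card {s. s < Suc d \<and> t < \<nu> s}"
  shows "\<exists>c. (\<forall>r. 0 \<le> c r) \<and> (\<forall>r > d. c r = 0) \<and>
    p1 * p2 = (\<Sum>r\<le>d. Polynomial.smult (c r) (newton_basis \<nu> r))"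
proof -
  define A where "A = {x. poly p1 x = 0}"
  define B where "B = {x. poly p2 x = 0}"
  have A: "finite A" "p1 = root_prod A" and B: "finite B" "p2 = root_prod B"
    using assms(1,2) unfolding interlaces_def A_def B_def by auto
  define ys where "ys = sorted_list_of_set A @ sorted_list_of_set B"
  define xs where "xs = rev (sort ys)"
  have "length xs = card A + card B" by (simp add: xs_def ys_def)
  then have len: "length xs \<le> d"
    using assms(4) A(2) B(2) degree_root_prod[of A] degree_root_prod[of B] by simp
  have "sorted_wrt (\<ge>) xs" by (simp add: xs_def sorted_wrt_rev)
  moreover have "length (filter (\<lambda>x. t < x) xs) \<le> card {s. s < Suc d \<and> t < \<nu> s}" for t
  proof -
    have "length (filter (\<lambda>x. t < x) xs) = length (filter (\<lambda>x. t < x) ys)"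
      by (simp add: xs_def flip: rev_filter) (simp add: filter_sort)
    also have "\<dots> = roots_above p1 t + roots_above p2 t"
      using A(1) B(1)
      by (simp add: ys_def distinct_length_filter roots_above_def A_def B_def Collect_conj_eq Int_commute)
    finally show ?thesis using assms(5)[of t] by simp
  qed
  ultimately have "xs ! s \<le> \<nu> s" if "s < length xs" for s
    using that len assms(3) by (intro sorted_nth_le_if_count_le[where n = "Suc d"]) auto
  then obtain c where c: "\<And>r. 0 \<le> c r" "\<And>r. r > length xs \<Longrightarrow> c r = 0"
      "(\<Prod>x\<leftarrow>xs. [:- x, 1:]) = (\<Sum>r\<le>length xs. Polynomial.smult (c r) (newton_basis \<nu> r))"
    using newton_coeffs_nonneg[of "Suc d" \<nu> xs] len assms(3) by auto
  have "(\<Prod>x\<leftarrow>xs. [:- x, 1:]) = prod_mset (image_mset (\<lambda>x. [:- x, 1:]) (mset xs))"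
    by (metis mset_map prod_mset_prod_list)
  also have "mset xs = mset ys" by (simp add: xs_def)
  also have "prod_mset (image_mset (\<lambda>x. [:- x, 1:]) (mset ys)) = (\<Prod>x\<leftarrow>ys. [:- x, 1:])"
    by (metis mset_map prod_mset_prod_list)
  also have "\<dots> = p1 * p2"
    unfolding A(2) B(2) using A(1) B(1)
    by (simp add: ys_def flip: prod.distinct_set_conv_list)
  finally have "p1 * p2 = (\<Sum>r\<le>length xs. Polynomial.smult (c r) (newton_basis \<nu> r))"
    using c(3) by simp
  also have "\<dots> = (\<Sum>r\<le>d. Polynomial.smult (c r) (newton_basis \<nu> r))"
    using len c(2) by (intro sum.mono_neutral_left) auto
  finally show ?thesis using c(1,2) len by (intro exI[of _ c]) auto
qed

section \<open>The adjugate of a Jacobi matrix\<close>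

locale jacobi_mat =
  fixes d :: nat and P :: "real mat" and \<theta> :: "nat \<Rightarrow> real"
  assumes carrier: "P \<in> carrier_mat (Suc d) (Suc d)"
    and tridiag: "tridiagonal_mat P"
    and up: "\<And>i. i < d \<Longrightarrow> 0 < P $$ (i, Suc i)"
    and low: "\<And>i. i < d \<Longrightarrow> 0 < P $$ (Suc i, i)"
    and eigs: "eigenvalue_listing P \<theta>"
    and mono: "mono_on {..d} \<theta>"
begin

lemma dim: "dim_row P = Suc d" "dim_col P = Suc d"
  using carrier by auto

lemma entry_0: "i \<le> d \<Longrightarrow> j \<le> d \<Longrightarrow> Suc i < j \<or> Suc j < i \<Longrightarrow> P $$ (i, j) = 0"
  using tridiag dim by (auto simp: tridiagonal_mat_def less_Suc_eq_le)

abbreviation a :: "nat \<Rightarrow> real" where "a i \<equiv> P $$ (i, i)"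
abbreviation c :: "nat \<Rightarrow> real" where "c n \<equiv> P $$ (n, n - 1) * P $$ (n - 1, n)"

text \<open>\<open>c 0\<close> is a junk value, and \<open>c (Suc d)\<close> reads outside the matrix; they only ever multiply
  \<open>continuant a c 0 = 0\<close> and \<open>\<psi> (Suc d) = 0\<close>.\<close>

definition \<phi> :: "nat \<Rightarrow> real poly" where "\<phi> i = continuant a c (Suc i)"
definition \<psi> :: "nat \<Rightarrow> real poly" where
  "\<psi> j = continuant (\<lambda>m. a (d - m)) (\<lambda>m. c (Suc d - m)) (Suc d - j)"
definition \<chi> :: "real poly" where "\<chi> = continuant a c (Suc (Suc d))"

lemma c_pos: "0 < m \<Longrightarrow> m \<le> d \<Longrightarrow> 0 < c m"
  using up[of "m - 1"] low[of "m - 1"] by simp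

lemma \<phi>_0: "\<phi> 0 = 1" by (simp add: \<phi>_def)
lemma \<phi>_1: "\<phi> (Suc 0) = [:- a 0, 1:]" by (simp add: \<phi>_def)
lemma \<phi>_rec: "\<phi> (Suc (Suc i)) = [:- a (Suc i), 1:] * \<phi> (Suc i) -
    Polynomial.smult (P $$ (Suc i, i) * P $$ (i, Suc i)) (\<phi> i)"
  unfolding \<phi>_def continuant.simps(3)[of _ _ "Suc i"] by simp

lemma \<psi>_d: "\<psi> d = 1" by (simp add: \<psi>_def Suc_diff_le)
lemma \<psi>_Suc_d: "\<psi> (Suc d) = 0" by (simp add: \<psi>_def)
lemma \<psi>_rec:
  assumes "Suc j \<le> d"
  shows "\<psi> j = [:- a (Suc j), 1:] * \<psi> (Suc j) -
    Polynomial.smult (P $$ (Suc (Suc j), Suc j) * P $$ (Suc j, Suc (Suc j))) (\<psi> (Suc (Suc j)))"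
proof -
  define m where "m = d - Suc j"
  have m: "d - m = Suc j" "Suc d - m = Suc (Suc j)" "Suc d - j = Suc (Suc m)"
      "Suc d - Suc j = Suc m" "Suc d - Suc (Suc j) = m"
    using assms by (auto simp: m_def)
  show ?thesis
    unfolding \<psi>_def m continuant.simps(3)[of _ _ m] by simp
qed

lemma \<chi>_split:
  assumes "i \<le> d"
  shows "\<chi> = \<phi> (Suc i) * \<psi> i -
    Polynomial.smult (P $$ (Suc i, i) * P $$ (i, Suc i)) (\<phi> i * \<psi> (Suc i))"
proof -
  define k where "k = d - i"
  have k: "k \<le> d" "Suc d - i = Suc k" "Suc d - Suc i = k" "d - k = i" using assms by (auto simp: k_def)
  show ?thesis
    using continuant_split[where a' = "\<lambda>m. a (d - m)" and a = a and c' = "\<lambda>m. c (Suc d - m)"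
        and c = c, OF _ _ k(1)]
    unfolding \<chi>_def \<phi>_def \<psi>_def k by simp
qed

lemma \<phi>_props:
  assumes "i \<le> d"
  shows "interlaces (Polynomial.smult (c i) (continuant a c i)) (\<phi> i)" "degree (\<phi> i) = i"
  unfolding \<phi>_def using assms c_pos by (auto intro!: interlaces_continuant)

lemma \<psi>_props:
  assumes "j \<le> d"
  shows "interlaces (Polynomial.smult (c (Suc j)) (\<psi> (Suc j))) (\<psi> j)" "degree (\<psi> j) = d - j"
proof -
  define m where "m = d - j"
  have m: "Suc d - m = Suc j" "Suc d - j = Suc m" "Suc d - Suc j = m" "m \<le> d"
    using assms by (auto simp: m_def)
  have pos: "0 < c (Suc d - k)" if "0 < k" "k \<le> m" for k
    using that m by (intro c_pos) auto
  show "interlaces (Polynomial.smult (c (Suc j)) (\<psi> (Suc j))) (\<psi> j)"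
    using interlaces_continuant(1)[of m "\<lambda>m. c (Suc d - m)" "\<lambda>m. a (d - m)"] pos
    unfolding \<psi>_def m by simp
  show "degree (\<psi> j) = d - j"
    using interlaces_continuant(2)[of m "\<lambda>m. c (Suc d - m)" "\<lambda>m. a (d - m)"] pos
    unfolding \<psi>_def m m_def by simp
qed

lemma \<chi>_props: "interlaces (\<phi> d) \<chi>" "degree \<chi> = Suc d"
  unfolding \<phi>_def \<chi>_def by (rule interlaces_continuant_last, erule (1) c_pos)+

lemma roots_above_\<phi>_\<psi>:
  assumes "i \<le> j" "j \<le> d"
  shows "roots_above (\<phi> i) t + roots_above (\<psi> j) t \<le> roots_above \<chi> t"
proof -
  have "\<chi> = [:- a i, 1:] * \<phi> i * \<psi> i - Polynomial.smult (c i) (continuant a c i) * \<psi> i -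
      \<phi> i * Polynomial.smult (c (Suc i)) (\<psi> (Suc i))"
    using \<chi>_split[of i] assms by (simp add: \<phi>_def algebra_simps)
  then have "roots_above (\<phi> i) t + roots_above (\<psi> i) t \<le> roots_above \<chi> t"
    using assms by (intro interlaces_combine[OF \<phi>_props(1) \<psi>_props(1) _ \<chi>_props(1)]) auto
  moreover have "roots_above (\<psi> j) t \<le> roots_above (\<psi> i) t"
  proof -
    have "Suc d - j = Suc (d - j)" "Suc d - i = Suc (d - i)" using assms by auto
    then show ?thesis unfolding \<psi>_def using assms
      by (simp only:) (intro roots_above_continuant_mono c_pos; simp)
  qed
  ultimately show ?thesis by simp
qed

definition B :: "nat \<Rightarrow> nat \<Rightarrow> real poly" where
  "B i j = (if i \<le> j then Polynomial.smult (\<Prod>m=i..<j. P $$ (m, Suc m)) (\<phi> i * \<psi> j)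
     else Polynomial.smult (\<Prod>m=j..<i. P $$ (Suc m, m)) (\<phi> j * \<psi> i))"

lemma tridiagonal_sum:
  fixes g :: "nat \<Rightarrow> real poly"
  assumes "j \<le> d"
  shows "(\<Sum>m\<le>d. Polynomial.smult (P $$ (m, j)) (g m)) =
    Polynomial.smult (a j) (g j) +
    (if j = 0 then 0 else Polynomial.smult (P $$ (j - 1, j)) (g (j - 1))) +
    (if j = d then 0 else Polynomial.smult (P $$ (Suc j, j)) (g (Suc j)))"
proof -
  let ?S = "{j} \<union> (if j = 0 then {} else {j - 1}) \<union> (if j = d then {} else {Suc j})"
  have "(\<Sum>m\<le>d. Polynomial.smult (P $$ (m, j)) (g m)) =
      (\<Sum>m\<in>?S. Polynomial.smult (P $$ (m, j)) (g m))"
  proof (rule sum.mono_neutral_right)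
    show "?S \<subseteq> {..d}" using assms by (auto split: if_splits)
    show "\<forall>m\<in>{..d} - ?S. Polynomial.smult (P $$ (m, j)) (g m) = 0"
      using assms by (auto intro!: entry_0 split: if_splits)
  qed simp
  also have "\<dots> = Polynomial.smult (a j) (g j) +
    (if j = 0 then 0 else Polynomial.smult (P $$ (j - 1, j)) (g (j - 1))) +
    (if j = d then 0 else Polynomial.smult (P $$ (Suc j, j)) (g (Suc j)))"
    by (cases j) auto
  finally show ?thesis .
qed

lemma B_row:
  assumes "i \<le> d" "j \<le> d"
  shows "[:0, 1:] * B i j = (\<Sum>m\<le>d. Polynomial.smult (P $$ (m, j)) (B i m)) + (if i = j then \<chi> else 0)"
proof -
  consider "i < j" | "i = j" | "j < i" by linarith
  then have "[:- a j, 1:] * B i j =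
    (if j = 0 then 0 else Polynomial.smult (P $$ (j - 1, j)) (B i (j - 1))) +
    (if j = d then 0 else Polynomial.smult (P $$ (Suc j, j)) (B i (Suc j))) + (if i = j then \<chi> else 0)"
  proof cases
    case 1
    then obtain k where k: "j = Suc k" "i \<le> k" by (cases j) auto
    define w where "w = (\<Prod>m=i..<k. P $$ (m, Suc m))"
    define x where "x = P $$ (k, Suc k)"
    have B: "B i k = Polynomial.smult w (\<phi> i * \<psi> k)" "B i j = Polynomial.smult (w * x) (\<phi> i * \<psi> j)"
      "B i (Suc j) = Polynomial.smult (w * x * P $$ (j, Suc j)) (\<phi> i * \<psi> (Suc j))"
      using k by (simp_all add: B_def w_def x_def)
    have \<psi>: "\<psi> k = [:- a j, 1:] * \<psi> j -
       Polynomial.smult (P $$ (Suc j, j) * P $$ (j, Suc j)) (\<psi> (Suc j))"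
      using \<psi>_rec[of k] k assms by simp
    have "[:- a j, 1:] * B i j = Polynomial.smult x (B i k) + Polynomial.smult (P $$ (Suc j, j)) (B i (Suc j))"
      unfolding B \<psi> by (simp add: algebra_simps smult_diff_right smult_add_right)
    moreover have "B i (Suc j) = 0" if "j = d" using B(3) \<psi>_Suc_d that by simp
    ultimately show ?thesis using k 1 by (auto simp: x_def)
  next
    case 2
    have "[:- a i, 1:] * (\<phi> i * \<psi> i) =
      (if i = 0 then 0 else Polynomial.smult (P $$ (i - 1, i)) (B i (i - 1))) +
      Polynomial.smult (P $$ (Suc i, i)) (B i (Suc i)) + \<chi>"
    proof (cases i)
      case 0
      have "B 0 (Suc 0) = Polynomial.smult (P $$ (0, Suc 0)) (\<psi> (Suc 0))"
        by (simp add: B_def \<phi>_0)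
      then show ?thesis unfolding 0 \<chi>_split[of 0, simplified] \<phi>_1 by (simp add: \<phi>_0 algebra_simps)
    next
      case (Suc k)
      have "B i k = Polynomial.smult (P $$ (Suc k, k)) (\<phi> k * \<psi> (Suc k))"
        "B i (Suc i) = Polynomial.smult (P $$ (i, Suc i)) (\<phi> i * \<psi> (Suc i))"
        using Suc by (simp_all add: B_def)
      then show ?thesis using \<chi>_split[of i] assms \<phi>_rec[of k] Suc
        by (simp add: algebra_simps smult_diff_right smult_add_right)
    qed
    moreover have "B i (Suc i) = 0" if "i = d" using \<psi>_Suc_d that by (simp add: B_def)
    moreover have "B i i = \<phi> i * \<psi> i" by (simp add: B_def)
    ultimately show ?thesis using 2 by auto
  next
    case 3
    then have "j < d" using assms by simp
    define w where "w = (\<Prod>m=Suc j..<i. P $$ (Suc m, m))"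
    define x where "x = P $$ (Suc j, j)"
    have B: "B i (Suc j) = Polynomial.smult w (\<phi> (Suc j) * \<psi> i)"
      "B i j = Polynomial.smult (x * w) (\<phi> j * \<psi> i)"
      using 3 by (cases "i = Suc j"; auto simp: B_def w_def x_def prod.atLeast_Suc_lessThan)+
    show ?thesis
    proof (cases j)
      case 0
      have "[:- a j, 1:] * B i j = Polynomial.smult x (B i (Suc j))"
        unfolding B unfolding 0 \<phi>_0 \<phi>_1
        by (simp add: algebra_simps smult_diff_right smult_add_right)
      then show ?thesis using 0 3 \<open>j < d\<close> by (simp add: x_def)
    next
      case (Suc k)
      have "B i k = Polynomial.smult (P $$ (j, k) * (x * w)) (\<phi> k * \<psi> i)"
        using 3 Suc by (simp add: B_def w_def x_def prod.atLeast_Suc_lessThan)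
      then have "[:- a j, 1:] * B i j =
          Polynomial.smult (P $$ (k, j)) (B i k) + Polynomial.smult x (B i (Suc j))"
        unfolding B unfolding Suc \<phi>_rec
        by (simp add: algebra_simps smult_diff_right smult_add_right)
      then show ?thesis using 3 \<open>j < d\<close> Suc by (simp add: x_def)
    qed
  qed
  moreover have "[:0, 1:] * B i j = [:- a j, 1:] * B i j + Polynomial.smult (a j) (B i j)"
    by simp
  ultimately show ?thesis unfolding tridiagonal_sum[OF assms(2)] by simp
qed

lemma root_\<chi>_eigenvalue:
  assumes "poly \<chi> x = 0"
  shows "poly (char_poly P) x = 0"
proof -
  define v where "v = vec (Suc d) (\<lambda>j. poly (B 0 j) x)"
  have "0 < (\<Prod>m=0..<d. P $$ (m, Suc m))" using up by (intro prod_pos) auto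
  then have "v $ d \<noteq> 0" by (simp add: v_def B_def \<phi>_0 \<psi>_d del: prod_zero_iff)
  then have "v \<noteq> 0\<^sub>v (Suc d)" by auto
  moreover have "transpose_mat P *\<^sub>v v = x \<cdot>\<^sub>v v"
  proof (rule eq_vecI)
    fix j assume "j < dim_vec (x \<cdot>\<^sub>v v)"
    then have j: "j \<le> d" by (simp add: v_def)
    have "x * poly (B 0 j) x = poly ([:0, 1:] * B 0 j) x" by simp
    also have "\<dots> = (\<Sum>m\<le>d. P $$ (m, j) * poly (B 0 m) x)"
      unfolding B_row[OF le0 j] using assms by (simp add: poly_sum)
    finally show "(transpose_mat P *\<^sub>v v) $ j = (x \<cdot>\<^sub>v v) $ j"
      using j dim by (simp add: v_def scalar_prod_def atLeast0LessThan lessThan_Suc_atMost)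
  qed (simp add: v_def dim)
  ultimately have "eigenvalue (transpose_mat P) x"
    unfolding eigenvalue_def eigenvector_def by (intro exI[of _ v]) (auto simp: v_def dim)
  then have "poly (char_poly (transpose_mat P)) x = 0"
    using carrier eigenvalue_root_char_poly[of "transpose_mat P" "Suc d"] by simp
  then show ?thesis using char_poly_transpose_mat[OF carrier] by simp
qed

text \<open>\<open>\<chi>\<close> has \<open>d + 1\<close> distinct roots by interlacing, and each of them is an eigenvalue, so no
  determinant of a tridiagonal matrix has to be expanded.\<close>

lemma char_poly_eq_\<chi>: "char_poly P = \<chi>"
proof -
  let ?T = "{x. poly \<chi> x = 0}"
  have T: "finite ?T" "\<chi> = root_prod ?T" using \<chi>_props(1) by (auto simp: interlaces_def)
  have "card ?T = Suc d" using \<chi>_props(2) T(2) degree_root_prod[of ?T] by simp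
  then have "char_poly P = root_prod ?T"
    using degree_monic_char_poly[OF carrier] T(1) root_\<chi>_eigenvalue
    by (intro monic_eq_root_prod) auto
  then show ?thesis using T(2) by simp
qed

definition \<nu> :: "nat \<Rightarrow> real" where "\<nu> s = \<theta> (d - s)"

lemma \<nu>_antimono: "i \<le> j \<Longrightarrow> j \<le> d \<Longrightarrow> \<nu> j \<le> \<nu> i"
  unfolding \<nu>_def by (rule mono_onD[OF mono]) auto

lemma \<chi>_eq_newton_basis: "\<chi> = newton_basis \<nu> (Suc d)"
proof -
  have "\<chi> = (\<Prod>i<Suc d. [:- \<theta> i, 1:])"
    using eigs char_poly_eq_\<chi> dim by (simp add: eigenvalue_listing_def)
  also have "\<dots> = (\<Prod>i<Suc d. [:- \<theta> (Suc d - Suc i), 1:])"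
    by (rule prod.nat_diff_reindex[symmetric])
  finally show ?thesis by (simp only: newton_basis_def \<nu>_def diff_Suc_Suc)
qed

lemma roots_above_\<chi>: "roots_above \<chi> t = card {s. s < Suc d \<and> t < \<nu> s}"
proof -
  let ?T = "{x. poly \<chi> x = 0}"
  have T: "finite ?T" "\<chi> = root_prod ?T" using \<chi>_props(1) by (auto simp: interlaces_def)
  have "card ?T = Suc d" using \<chi>_props(2) T(2) degree_root_prod[of ?T] by simp
  moreover have im: "?T = \<nu> ` {..<Suc d}"
    unfolding \<chi>_eq_newton_basis using poly_newton_basis_eq_0 by blast
  ultimately have inj: "inj_on \<nu> {..<Suc d}" by (intro eq_card_imp_inj_on) auto
  have "{x. poly \<chi> x = 0 \<and> t < x} = {x \<in> \<nu> ` {..<Suc d}. t < x}" using im by auto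
  also have "\<dots> = \<nu> ` {s. s < Suc d \<and> t < \<nu> s}" by auto
  finally have "roots_above \<chi> t = card (\<nu> ` {s. s < Suc d \<and> t < \<nu> s})"
    by (simp only: roots_above_def)
  also have "\<dots> = card {s. s < Suc d \<and> t < \<nu> s}"
    using inj by (intro card_image) (auto intro: inj_on_subset)
  finally show ?thesis .
qed

lemma B_newton:
  assumes "i \<le> d" "j \<le> d"
  shows "\<exists>b. (\<forall>r. 0 \<le> b r) \<and> (\<forall>r > d. b r = 0) \<and>
    B i j = (\<Sum>r\<le>d. Polynomial.smult (b r) (newton_basis \<nu> r))"
proof -
  have *: "\<exists>b. (\<forall>r. 0 \<le> b r) \<and> (\<forall>r > d. b r = 0) \<and>
    Polynomial.smult w (\<phi> k * \<psi> l) = (\<Sum>r\<le>d. Polynomial.smult (b r) (newton_basis \<nu> r))"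
    if "k \<le> l" "l \<le> d" "0 \<le> w" for k l and w :: real
  proof -
    have "\<exists>b. (\<forall>r. 0 \<le> b r) \<and> (\<forall>r > d. b r = 0) \<and>
        \<phi> k * \<psi> l = (\<Sum>r\<le>d. Polynomial.smult (b r) (newton_basis \<nu> r))"
    proof (rule newton_coeffs_nonneg_product)
      show "interlaces (Polynomial.smult (c k) (continuant a c k)) (\<phi> k)"
        using that by (intro \<phi>_props) auto
      show "interlaces (Polynomial.smult (c (Suc l)) (\<psi> (Suc l))) (\<psi> l)"
        using that by (intro \<psi>_props) auto
      show "degree (\<phi> k) + degree (\<psi> l) \<le> d"
        using that \<phi>_props(2)[of k] \<psi>_props(2)[of l] by simp
      show "roots_above (\<phi> k) t + roots_above (\<psi> l) t \<le> card {s. s < Suc d \<and> t < \<nu> s}" for t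
        using roots_above_\<phi>_\<psi>[OF that(1,2)] roots_above_\<chi> by simp
    qed (rule \<nu>_antimono)
    then obtain b where "\<And>r. 0 \<le> b r" "\<And>r. r > d \<Longrightarrow> b r = 0"
        "\<phi> k * \<psi> l = (\<Sum>r\<le>d. Polynomial.smult (b r) (newton_basis \<nu> r))" by blast
    then show ?thesis using that(3)
      by (intro exI[of _ "\<lambda>r. w * b r"]) (simp add: smult_sum2)
  qed
  show ?thesis
  proof (cases "i \<le> j")
    case True
    have "0 \<le> (\<Prod>m=i..<j. P $$ (m, Suc m))"
      using assms up by (intro prod_nonneg) (force intro: less_imp_le)
    then show ?thesis using *[OF True assms(2)] True by (simp add: B_def)
  next
    case False
    have "0 \<le> (\<Prod>m=j..<i. P $$ (Suc m, m))"
      using assms low by (intro prod_nonneg) (force intro: less_imp_le)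
    then show ?thesis using *[OF _ assms(1), of j] False by (simp add: B_def)
  qed
qed

lemma newton_basis_times_X:
  "[:0, 1:] * newton_basis \<nu> r = newton_basis \<nu> (Suc r) + Polynomial.smult (\<nu> r) (newton_basis \<nu> r)"
  by (simp add: newton_basis_Suc)

lemma newton_coeffs_recursion:
  assumes b: "\<And>i j. i \<le> d \<Longrightarrow> j \<le> d \<Longrightarrow>
      B i j = (\<Sum>r\<le>d. Polynomial.smult (b i j r) (newton_basis \<nu> r))"
    and b0: "\<And>i j r. i \<le> d \<Longrightarrow> j \<le> d \<Longrightarrow> r > d \<Longrightarrow> b i j r = 0"
    and ij: "i \<le> d" "j \<le> d" and r: "r \<le> Suc d"
  shows "(if r = 0 then 0 else b i j (r - 1)) + \<nu> r * b i j r =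
    (\<Sum>m\<le>d. b i m r * P $$ (m, j)) + (if i = j \<and> r = Suc d then 1 else 0)"
proof -
  have "(\<Sum>r\<le>Suc d. Polynomial.smult ((if r = 0 then 0 else b i j (r - 1)) + \<nu> r * b i j r) (newton_basis \<nu> r))
    = (\<Sum>r\<le>Suc d. Polynomial.smult (if r = 0 then 0 else b i j (r - 1)) (newton_basis \<nu> r)) +
      (\<Sum>r\<le>Suc d. Polynomial.smult (\<nu> r * b i j r) (newton_basis \<nu> r))"
    by (simp only: smult_add_left sum.distrib)
  also have "\<dots> = (\<Sum>r\<le>d. Polynomial.smult (b i j r) (newton_basis \<nu> (Suc r))) +
      (\<Sum>r\<le>d. Polynomial.smult (\<nu> r * b i j r) (newton_basis \<nu> r))"
    by (subst sum.atMost_Suc_shift) (simp add: b0[OF ij])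
  also have "\<dots> = [:0, 1:] * B i j"
    unfolding b[OF ij] sum_distrib_left mult_smult_right newton_basis_times_X smult_add_right sum.distrib
    by (simp add: mult.commute)
  also have "\<dots> = (\<Sum>m\<le>d. Polynomial.smult (P $$ (m, j)) (B i m)) + (if i = j then \<chi> else 0)"
    by (rule B_row[OF ij])
  also have "(\<Sum>m\<le>d. Polynomial.smult (P $$ (m, j)) (B i m)) =
      (\<Sum>m\<le>d. \<Sum>r\<le>d. Polynomial.smult (b i m r * P $$ (m, j)) (newton_basis \<nu> r))"
    by (intro sum.cong refl) (simp add: b ij smult_sum2 mult.commute)
  also have "\<dots> = (\<Sum>r\<le>d. Polynomial.smult (\<Sum>m\<le>d. b i m r * P $$ (m, j)) (newton_basis \<nu> r))"
    by (subst sum.swap) (simp add: smult_sum)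
  also have "\<dots> = (\<Sum>r\<le>Suc d. Polynomial.smult (\<Sum>m\<le>d. b i m r * P $$ (m, j)) (newton_basis \<nu> r))"
    using ij by (simp add: b0)
  also have "(if i = j then \<chi> else 0) = (\<Sum>r\<le>Suc d. Polynomial.smult (if i = j \<and> r = Suc d then 1 else 0) (newton_basis \<nu> r))"
    by (simp add: \<chi>_eq_newton_basis)
  also have "(\<Sum>r\<le>Suc d. Polynomial.smult (\<Sum>m\<le>d. b i m r * P $$ (m, j)) (newton_basis \<nu> r)) + \<dots> =
    (\<Sum>r\<le>Suc d. Polynomial.smult ((\<Sum>m\<le>d. b i m r * P $$ (m, j)) + (if i = j \<and> r = Suc d then 1 else 0))
      (newton_basis \<nu> r))"
    by (simp only: smult_add_left sum.distrib)
  finally show ?thesis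
    by (rule newton_basis_unique[OF _ r,
        of "\<lambda>r. (if r = 0 then 0 else b i j (r - 1)) + \<nu> r * b i j r" \<nu>
           "\<lambda>r. (\<Sum>m\<le>d. b i m r * P $$ (m, j)) + (if i = j \<and> r = Suc d then 1 else 0)"])
qed

lemma shifted_prod_carrier: "shifted_prod P \<theta> k \<in> carrier_mat (Suc d) (Suc d)"
  using carrier by (induction k) (auto simp: dim)

lemma shifted_prod_Suc_entry:
  assumes "i \<le> d" "j \<le> d"
  shows "shifted_prod P \<theta> (Suc k) $$ (i, j) =
    (\<Sum>m\<le>d. shifted_prod P \<theta> k $$ (i, m) * P $$ (m, j)) - \<theta> k * shifted_prod P \<theta> k $$ (i, j)"
proof -
  have "shifted_prod P \<theta> (Suc k) $$ (i, j) =
    (\<Sum>m\<le>d. shifted_prod P \<theta> k $$ (i, m) * (P $$ (m, j) - \<theta> k * (if m = j then 1 else 0)))"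
    using assms shifted_prod_carrier[of k] carrier
    by (auto simp: scalar_prod_def dim atLeast0LessThan lessThan_Suc_atMost intro!: sum.cong)
  also have "\<dots> = (\<Sum>m\<le>d. shifted_prod P \<theta> k $$ (i, m) * P $$ (m, j)) -
      (\<Sum>m\<le>d. if m = j then \<theta> k * shifted_prod P \<theta> k $$ (i, m) else 0)"
    unfolding sum_subtractf[symmetric] by (intro sum.cong) (auto simp: algebra_simps)
  finally show ?thesis using assms by simp
qed

lemma shifted_prod_nonneg_and_annihilates:
  shows "i \<le> d \<Longrightarrow> j \<le> d \<Longrightarrow> k \<le> d \<Longrightarrow> 0 \<le> shifted_prod P \<theta> k $$ (i, j)"
    and "i \<le> d \<Longrightarrow> j \<le> d \<Longrightarrow> shifted_prod P \<theta> (Suc d) $$ (i, j) = 0"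
proof -
  define b where "b i j = (SOME b. (\<forall>r. 0 \<le> b r) \<and> (\<forall>r > d. b r = 0) \<and>
    B i j = (\<Sum>r\<le>d. Polynomial.smult (b r) (newton_basis \<nu> r)))" for i j
  have "(\<forall>r. 0 \<le> b i j r) \<and> (\<forall>r > d. b i j r = 0) \<and>
    B i j = (\<Sum>r\<le>d. Polynomial.smult (b i j r) (newton_basis \<nu> r))" if "i \<le> d" "j \<le> d" for i j
    unfolding b_def by (rule someI_ex[OF B_newton[OF that]])
  then have nonneg: "\<And>i j r. i \<le> d \<Longrightarrow> j \<le> d \<Longrightarrow> 0 \<le> b i j r"
    and b: "\<And>i j r. i \<le> d \<Longrightarrow> j \<le> d \<Longrightarrow> r > d \<Longrightarrow> b i j r = 0"
      "\<And>i j. i \<le> d \<Longrightarrow> j \<le> d \<Longrightarrow> B i j = (\<Sum>r\<le>d. Polynomial.smult (b i j r) (newton_basis \<nu> r))"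
    by blast+
  note rec = newton_coeffs_recursion[of b, OF b(2,1)]
  have S: "k \<le> d \<Longrightarrow> i \<le> d \<Longrightarrow> j \<le> d \<Longrightarrow> shifted_prod P \<theta> k $$ (i, j) = b i j (d - k)" for i j k
  proof (induction k arbitrary: i j)
    case 0
    then show ?case using rec[of i j "Suc d"] b(1)[of _ _ "Suc d"] by (simp add: dim)
  next
    case (Suc k)
    have "\<nu> (d - k) = \<theta> k" using Suc.prems by (simp add: \<nu>_def)
    moreover have "d - k \<noteq> 0" "d - k \<noteq> Suc d" "d - k \<le> Suc d" "d - k - 1 = d - Suc k"
      using Suc.prems by auto
    ultimately have "b i j (d - Suc k) + \<theta> k * b i j (d - k) = (\<Sum>m\<le>d. b i m (d - k) * P $$ (m, j))"
      using rec[of i j "d - k"] Suc.prems by simp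
    moreover have "shifted_prod P \<theta> k $$ (i, m) = b i m (d - k)" if "m \<le> d" for m
      using Suc.IH[of i m] Suc.prems that by simp
    ultimately show ?case
      unfolding shifted_prod_Suc_entry[OF Suc.prems(2,3)] using Suc.prems by simp
  qed
  show "i \<le> d \<Longrightarrow> j \<le> d \<Longrightarrow> k \<le> d \<Longrightarrow> 0 \<le> shifted_prod P \<theta> k $$ (i, j)"
    using S nonneg by simp
  show "shifted_prod P \<theta> (Suc d) $$ (i, j) = 0" if "i \<le> d" "j \<le> d"
    unfolding shifted_prod_Suc_entry[OF that]
    using that rec[of i j 0] by (simp add: S \<nu>_def)
qed

end

section \<open>Irreducible birth-and-death chains\<close>

lemma irreducible_leaves_proper_subset:
  fixes P :: "real mat"
  assumes P: "P \<in> carrier_mat n n" and irr: "irreducible_mat P"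
    and C: "i \<in> C" "i < n" "j < n" "j \<notin> C"
  obtains s t where "s \<in> C" "t \<notin> C" "s < n" "t < n" "P $$ (s, t) \<noteq> 0"
proof (rule ccontr)
  assume "\<not> thesis"
  then have closed: "\<And>s t. s \<in> C \<Longrightarrow> t \<notin> C \<Longrightarrow> s < n \<Longrightarrow> t < n \<Longrightarrow> P $$ (s, t) = 0"
    using that by blast
  have "s \<in> C \<Longrightarrow> t \<notin> C \<Longrightarrow> s < n \<Longrightarrow> t < n \<Longrightarrow> (P ^\<^sub>m m) $$ (s, t) = 0" for m s t
  proof (induction m arbitrary: t)
    case 0
    then show ?case using P by auto
  next
    case (Suc m)
    have "P ^\<^sub>m m \<in> carrier_mat n n" using P by (rule pow_carrier_mat)
    then have "(P ^\<^sub>m Suc m) $$ (s, t) = (\<Sum>r<n. (P ^\<^sub>m m) $$ (s, r) * P $$ (r, t))"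
      using P Suc.prems by (simp add: scalar_prod_def atLeast0LessThan)
    also have "\<dots> = 0"
    proof (intro sum.neutral ballI)
      fix r assume "r \<in> {..<n}"
      then show "(P ^\<^sub>m m) $$ (s, r) * P $$ (r, t) = 0"
        using closed[of r t] Suc by (cases "r \<in> C") auto
    qed
    finally show ?case .
  qed
  then show False using irr C P unfolding irreducible_mat_def by (metis carrier_matD(1) less_irrefl)
qed

lemma tridiagonal_left_eigenvector_unique:
  fixes P :: "real mat" and x y :: "nat \<Rightarrow> real"
  assumes zero: "\<And>i j. i \<le> d \<Longrightarrow> j \<le> d \<Longrightarrow> Suc j < i \<Longrightarrow> P $$ (i, j) = 0"
    and low: "\<And>i. i < d \<Longrightarrow> P $$ (Suc i, i) \<noteq> 0"
    and x: "\<And>j. j \<le> d \<Longrightarrow> (\<Sum>i\<le>d. x i * P $$ (i, j)) = x j" "(\<Sum>i\<le>d. x i) = 1"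
    and y: "\<And>j. j \<le> d \<Longrightarrow> (\<Sum>i\<le>d. y i * P $$ (i, j)) = y j" "(\<Sum>i\<le>d. y i) = 1"
    and "j \<le> d"
  shows "x j = y j"
proof -
  have vanish: "z j = 0"
    if z: "\<And>j. j \<le> d \<Longrightarrow> (\<Sum>i\<le>d. z i * P $$ (i, j)) = z j" and z0: "z 0 = 0" and "j \<le> d"
    for z :: "nat \<Rightarrow> real" and j
    using \<open>j \<le> d\<close>
  proof (induction j rule: less_induct)
    case (less j)
    show ?case
    proof (cases j)
      case (Suc k)
      have "(\<Sum>i\<le>d. z i * P $$ (i, k)) = (\<Sum>i\<in>{j}. z i * P $$ (i, k))"
      proof (rule sum.mono_neutral_right)
        show "\<forall>i\<in>{..d} - {j}. z i * P $$ (i, k) = 0"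
        proof
          fix i assume i: "i \<in> {..d} - {j}"
          show "z i * P $$ (i, k) = 0"
            using i Suc less.IH[of i] less.prems zero[of i k] by (cases "i < j") auto
        qed
      qed (use less.prems in auto)
      moreover have "z k = 0" using less Suc by auto
      ultimately show ?thesis using z[of k] low[of k] Suc less.prems by auto
    qed (simp add: z0)
  qed
  have lin: "x 0 * y j - y 0 * x j = 0" if "j \<le> d" for j
  proof (rule vanish[OF _ _ that])
    fix j assume "j \<le> d"
    have "(\<Sum>i\<le>d. (x 0 * y i - y 0 * x i) * P $$ (i, j)) =
        x 0 * (\<Sum>i\<le>d. y i * P $$ (i, j)) - y 0 * (\<Sum>i\<le>d. x i * P $$ (i, j))"
      by (simp add: sum_distrib_left sum_subtractf algebra_simps)
    then show "(\<Sum>i\<le>d. (x 0 * y i - y 0 * x i) * P $$ (i, j)) = x 0 * y j - y 0 * x j"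
      using x(1) y(1) \<open>j \<le> d\<close> by simp
  qed simp
  have "x 0 * (\<Sum>i\<le>d. y i) - y 0 * (\<Sum>i\<le>d. x i) = (\<Sum>i\<le>d. x 0 * y i - y 0 * x i)"
    by (simp add: sum_distrib_left sum_subtractf)
  also have "\<dots> = 0" using lin by (intro sum.neutral) auto
  finally have "x 0 = y 0" using x(2) y(2) by simp
  moreover have "x 0 \<noteq> 0"
  proof
    assume "x 0 = 0"
    then have "x j = 0" if "j \<le> d" for j using vanish[OF x(1)] that by blast
    then have "(\<Sum>i\<le>d. x i) = 0" by (intro sum.neutral) auto
    then show False using x(2) by simp
  qed
  ultimately show ?thesis using lin[OF \<open>j \<le> d\<close>] by simp
qed

lemma jacobi_mat_of_irreducible_birth_death:
  assumes "birth_death_mat d P" "irreducible_mat P" "eigenvalue_listing P \<theta>" "mono_on {..d} \<theta>"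
  shows "jacobi_mat d P \<theta>"
proof
  have st: "stochastic_mat (Suc d) P" and tri: "tridiagonal_mat P"
    using assms(1) by (auto simp: birth_death_mat_def)
  show P: "P \<in> carrier_mat (Suc d) (Suc d)" using st by (simp add: stochastic_mat_def)
  show "tridiagonal_mat P" by (rule tri)
  show "eigenvalue_listing P \<theta>" "mono_on {..d} \<theta>" by fact+
  have near: "t \<le> Suc s \<and> s \<le> Suc t" if "P $$ (s, t) \<noteq> 0" "s < Suc d" "t < Suc d" for s t
  proof (rule ccontr)
    assume "\<not> ?thesis"
    then show False using tri P that unfolding tridiagonal_mat_def by (auto simp: not_le)
  qed
  have nonneg: "0 \<le> P $$ (s, t)" if "s < Suc d" "t < Suc d" for s t
    using st that by (simp add: stochastic_mat_def)
  fix i assume "i < d"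
  obtain s t where "s \<in> {..i}" "t \<notin> {..i}" "s < Suc d" "t < Suc d" "P $$ (s, t) \<noteq> 0"
    using irreducible_leaves_proper_subset[OF P assms(2), of i "{..i}" "Suc i"] \<open>i < d\<close> by auto
  moreover from this have "s = i" "t = Suc i" using near[of s t] by auto
  ultimately show "0 < P $$ (i, Suc i)" using nonneg[of s t] by simp
  obtain s t where "s \<in> {i<..}" "t \<notin> {i<..}" "s < Suc d" "t < Suc d" "P $$ (s, t) \<noteq> 0"
    using irreducible_leaves_proper_subset[OF P assms(2), of "Suc i" "{i<..}" i] \<open>i < d\<close> by auto
  moreover from this have "s = Suc i" "t = i" using near[of s t] by auto
  ultimately show "0 < P $$ (Suc i, i)" using nonneg[of s t] by simp
qed

theorem lemma4p1:
  fixes d :: nat and P :: "real mat" and \<pi> :: "real vec" and \<theta> :: "nat \<Rightarrow> real"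
  assumes "birth_death_mat d P"
    and "ergodic_mat P"
    and "stationary_pmf P \<pi>"
    and "eigenvalue_listing P \<theta>"
    and "0 \<le> \<theta> 0"
    and "mono_on {..d} \<theta>"
    and "0 < d \<longrightarrow> \<theta> (d - 1) < \<theta> d"
    and "\<theta> d = 1"
  shows "(\<forall>k\<le>d. stochastic_mat (d + 1) (spectral_poly P \<theta> k)) \<and>
         (\<forall>i\<le>d. row (spectral_poly P \<theta> d) i = \<pi>)"
proof -
  interpret jacobi_mat d P \<theta>
    using assms by (intro jacobi_mat_of_irreducible_birth_death) (auto simp: ergodic_mat_def)
  have P_rows: "(\<Sum>j\<le>d. P $$ (m, j)) = 1" if "m \<le> d" for m
    using assms(1) that
    by (simp add: birth_death_mat_def stochastic_mat_def lessThan_Suc_atMost less_Suc_eq_le)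
  have \<theta>_less: "\<theta> j < 1" if "j < d" for j
    using mono_onD[OF assms(6), of j "d - 1"] assms(7,8) that by simp linarith
  have S_rows: "(\<Sum>j\<le>d. shifted_prod P \<theta> k $$ (i, j)) = (\<Prod>j<k. 1 - \<theta> j)" if "i \<le> d" for i k
  proof (induction k)
    case 0
    then show ?case using that by (simp add: dim)
  next
    case (Suc k)
    let ?S = "shifted_prod P \<theta> k"
    have "(\<Sum>j\<le>d. shifted_prod P \<theta> (Suc k) $$ (i, j)) =
        (\<Sum>j\<le>d. \<Sum>m\<le>d. ?S $$ (i, m) * P $$ (m, j)) - \<theta> k * (\<Sum>j\<le>d. ?S $$ (i, j))"
      unfolding sum_distrib_left sum_subtractf[symmetric]
      using that by (intro sum.cong refl shifted_prod_Suc_entry) auto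
    also have "(\<Sum>j\<le>d. \<Sum>m\<le>d. ?S $$ (i, m) * P $$ (m, j)) = (\<Sum>m\<le>d. ?S $$ (i, m))"
      by (subst sum.swap) (simp add: P_rows flip: sum_distrib_left)
    finally show ?case by (simp add: Suc algebra_simps)
  qed
  define w where "w k = (\<Prod>j<k. inverse (1 - \<theta> j))" for k
  have w_pos: "0 < w k" if "k \<le> d" for k
    unfolding w_def using \<theta>_less that by (intro prod_pos) auto
  have w_inv: "w k * (\<Prod>j<k. 1 - \<theta> j) = 1" if "k \<le> d" for k
  proof -
    have "1 - \<theta> j \<noteq> 0" if "j < k" for j using \<theta>_less[of j] that \<open>k \<le> d\<close> by simp
    then show ?thesis unfolding w_def prod.distrib[symmetric] by (intro prod.neutral) auto
  qed
  have Q: "spectral_poly P \<theta> k $$ (i, j) = w k * shifted_prod P \<theta> k $$ (i, j)"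
    if "i \<le> d" "j \<le> d" for i j k
    using that shifted_prod_carrier[of k] by (simp add: spectral_poly_def w_def)
  have Q_carrier: "spectral_poly P \<theta> k \<in> carrier_mat (Suc d) (Suc d)" for k
    using shifted_prod_carrier[of k] by (simp add: spectral_poly_def)
  have Q_rows: "(\<Sum>j\<le>d. spectral_poly P \<theta> k $$ (i, j)) = 1" if "i \<le> d" "k \<le> d" for i k
    using that S_rows w_inv by (simp add: Q flip: sum_distrib_left)
  have "stochastic_mat (d + 1) (spectral_poly P \<theta> k)" if "k \<le> d" for k
    unfolding stochastic_mat_def
  proof (intro conjI allI impI)
    show "spectral_poly P \<theta> k \<in> carrier_mat (d + 1) (d + 1)" using Q_carrier by simp
    fix i assume i: "i < d + 1"
    then show "(\<Sum>j<d + 1. spectral_poly P \<theta> k $$ (i, j)) = 1"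
      using Q_rows[of i k] that by (simp add: lessThan_Suc_atMost)
    fix j assume "j < d + 1"
    then show "0 \<le> spectral_poly P \<theta> k $$ (i, j)"
      using i that w_pos[of k] shifted_prod_nonneg_and_annihilates(1)[of i j k] by (simp add: Q)
  qed
  moreover have "row (spectral_poly P \<theta> d) i = \<pi>" if "i \<le> d" for i
  proof (rule eq_vecI)
    have \<pi>: "\<pi> \<in> carrier_vec (Suc d)" "(\<Sum>i\<le>d. \<pi> $ i) = 1"
        "\<And>j. j \<le> d \<Longrightarrow> (\<Sum>i\<le>d. \<pi> $ i * P $$ (i, j)) = \<pi> $ j"
      using assms(3) by (auto simp: stationary_pmf_def prob_vec_def dim lessThan_Suc_atMost less_Suc_eq_le)
    then show "dim_vec (row (spectral_poly P \<theta> d) i) = dim_vec \<pi>"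
      using Q_carrier[of d] by simp
    fix j assume "j < dim_vec \<pi>"
    then have j: "j \<le> d" using \<pi>(1) by simp
    have "spectral_poly P \<theta> d $$ (i, j) = \<pi> $ j"
    proof (rule tridiagonal_left_eigenvector_unique[where P = P and d = d and x = "\<lambda>j. spectral_poly P \<theta> d $$ (i, j)"])
      fix j assume j: "j \<le> d"
      have "(\<Sum>m\<le>d. shifted_prod P \<theta> d $$ (i, m) * P $$ (m, j)) = shifted_prod P \<theta> d $$ (i, j)"
        using shifted_prod_nonneg_and_annihilates(2)[OF that j] shifted_prod_Suc_entry[OF that j, of d]
          assms(8) by simp
      then show "(\<Sum>m\<le>d. spectral_poly P \<theta> d $$ (i, m) * P $$ (m, j)) = spectral_poly P \<theta> d $$ (i, j)"
        using that j by (simp add: Q mult.assoc flip: sum_distrib_left)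
    next
      show "P $$ (Suc i, i) \<noteq> 0" if "i < d" for i using low[OF that] by simp
    qed (use that j \<pi> Q_rows entry_0 in auto)
    then show "row (spectral_poly P \<theta> d) i $ j = \<pi> $ j"
      using that j Q_carrier[of d] by simp
  qed
  ultimately show ?thesis by blast
qed

end
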